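(* Let a user-to-base-station allocation and SINR requirements $\gamma_k>0$ be fixed, and let $\mathcal{H}$ be the (compact) set of strictly $\gamma_k$-feasible channels under consideration. Then the optimal dual multipliers $\{\lambda_k^\star\}$, $k=1,\dots,K$, associated with the SINR constraints of the centralized beam-forming problem are continuous functions of the channel $\mathbf{H}$ on $\mathcal{H}$.
   Context: There are $B$ base stations with $N_T$ antennas each and $K$ single-antenna users. User $k$ is served by base station $b(k)$, and $\mathcal{U}(b)=\{k: b(k)=b\}$. $\mathbf{h}_{mk}\in\mathbb{C}^{N_T}$ is the channel from base station $m$ to user $k$, $\mathbf{H}$ is the collection of all $\mathbf{h}_{mk}$, $\mathbf{w}_k\in\mathbb{C}^{N_T}$ is the beam-former for user $k$, and $\mathbf{W}=(\mathbf{w}_1,\dots,\mathbf{w}_K)$. Noise variances $\sigma_k^2>0$ are fixed. Define $$\mathrm{SINR}_k(\mathbf{W},\mathbf{H})=\frac{|\mathbf{h}_{b(k)k}^H\mathbf{w}_k|^2}{\sum_{i\in\mathcal{U}(b(k))\setminus k}|\mathbf{h}_{b(k)k}^H\mathbf{w}_i|^2+\sum_{m\ne b(k)}\sum_{i\in\mathcal{U}(m)}|\mathbf{h}_{mk}^H\mathbf{w}_i|^2+\sigma_k^2}.$$ Centralized problem: minimize $\sum_k\|\mathbf{w}_k\|^2$ subject to $\mathrm{SINR}_k(\mathbf{W},\mathbf{H})\ge\gamma_k$ for all $k$. $\mathbf{H}$ is strictly $\gamma_k$-feasible if there is $\mathbf{W}$ with $\mathrm{SINR}_k(\mathbf{W},\mathbf{H})>\gamma_k$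 for all $k$. The dual problem (Lagrange multipliers $\lambda_k\ge0$ for the constraints written as $\frac{1}{\gamma_k}|\mathbf{h}_{b(k)k}^H\mathbf{w}_k|^2-\sum_{i\neq k}|\mathbf{h}_{b(i)k}^H\mathbf{w}_i|^2-\sigma_k^2\ge0$) is $$\max_{\lambda_1,\dots,\lambda_K\ge0}\ \sum_{k=1}^K\lambda_k\sigma_k^2\quad\text{s.t.}\quad \mathbf{I}+\sum_{j=1}^K\lambda_j\mathbf{h}_{b(k)j}\mathbf{h}_{b(k)j}^H\succeq\Big(1+\frac1{\gamma_k}\Big)\lambda_k\mathbf{h}_{b(k)k}\mathbf{h}_{b(k)k}^H,\quad k=1,\dots,K,$$ and $\{\lambda_k^\star\}$ denotes its optimal solution. *)

theory Defs
  imports "HOL-Analysis.Analysis"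
begin

text \<open>\<open>cdot x y\<close> is $x^H y$. The library's \<open>\<bullet>\<close> on \<^typ>\<open>complex^'n\<close> is only its real part.\<close>

definition cdot :: "complex^'n \<Rightarrow> complex^'n \<Rightarrow> complex" where
  "cdot x y = (\<Sum>i\<in>UNIV. cnj (x $ i) * y $ i)"

text \<open>\<open>outer x y\<close> is $x y^H$.\<close>

definition outer :: "complex^'n \<Rightarrow> complex^'n \<Rightarrow> complex^'n^'n" where
  "outer x y = (\<chi> i j. x $ i * cnj (y $ j))"

definition adj :: "complex^'n^'n \<Rightarrow> complex^'n^'n" where
  "adj A = (\<chi> i j. cnj (A $ j $ i))"

definition psd :: "complex^'n^'n \<Rightarrow> bool" where
  "psd A \<longleftrightarrow> adj A = A \<and> (\<forall>x. 0 \<le> Re (cdot x (A *v x)))"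

definition loewner_ge :: "complex^'n^'n \<Rightarrow> complex^'n^'n \<Rightarrow> bool" (infix "\<succeq>" 50) where
  "A \<succeq> B \<longleftrightarrow> psd (A - B)"

text \<open>
  The index types \<open>'b\<close>, \<open>'k\<close>, \<open>'n\<close> stand for the base stations, the users and the antennas of a
  base station. A channel collection \<open>H\<close> has \<open>H $ m $ k\<close> as the channel from base station \<open>m\<close> to
  user \<open>k\<close>; a collection \<open>W\<close> of beam-formers has \<open>W $ k\<close> as the beam-former of user \<open>k\<close>. The map
  \<open>b\<close> assigns to each user its serving base station, and \<open>\<sigma> k\<close> is a standard deviation, so that
  the noise variance of user \<open>k\<close> is \<open>(\<sigma> k)\<^sup>2\<close>.
\<close>

definition users :: "('k \<Rightarrow> 'b) \<Rightarrow> 'b \<Rightarrow> 'k set" where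
  "users b m = {k. b k = m}"

definition SINR ::
  "('k::finite \<Rightarrow> 'b::finite) \<Rightarrow> ('k \<Rightarrow> real) \<Rightarrow> complex^'n^'k \<Rightarrow> complex^'n^'k^'b \<Rightarrow> 'k \<Rightarrow> real"
where
  "SINR b \<sigma> W H k =
     (cmod (cdot (H $ b k $ k) (W $ k)))\<^sup>2 /
     ((\<Sum>i\<in>users b (b k) - {k}. (cmod (cdot (H $ b k $ k) (W $ i)))\<^sup>2)
      + (\<Sum>m\<in>UNIV - {b k}. \<Sum>i\<in>users b m. (cmod (cdot (H $ m $ k) (W $ i)))\<^sup>2)
      + (\<sigma> k)\<^sup>2)"

definition strictly_feasible ::
  "('k::finite \<Rightarrow> 'b::finite) \<Rightarrow> ('k \<Rightarrow> real) \<Rightarrow> ('k \<Rightarrow> real) \<Rightarrow> complex^'n^'k^'b \<Rightarrow> bool"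
where
  "strictly_feasible b \<gamma> \<sigma> H \<longleftrightarrow> (\<exists>W. \<forall>k. SINR b \<sigma> W H k > \<gamma> k)"

definition dual_feasible ::
  "('k::finite \<Rightarrow> 'b::finite) \<Rightarrow> ('k \<Rightarrow> real) \<Rightarrow> complex^'n^'k^'b \<Rightarrow> real^'k \<Rightarrow> bool"
where
  "dual_feasible b \<gamma> H l \<longleftrightarrow>
     (\<forall>k. 0 \<le> l $ k) \<and>
     (\<forall>k. mat 1 + (\<Sum>j\<in>UNIV. (l $ j) *\<^sub>R outer (H $ b k $ j) (H $ b k $ j))
          \<succeq> ((1 + 1 / \<gamma> k) * l $ k) *\<^sub>R outer (H $ b k $ k) (H $ b k $ k))"

definition dual_optimal ::
  "('k::finite \<Rightarrow> 'b::finite) \<Rightarrow> ('k \<Rightarrow> real) \<Rightarrow> ('k \<Rightarrow> real) \<Rightarrow> complex^'n^'k^'b \<Rightarrow> real^'k \<Rightarrow> bool"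
where
  "dual_optimal b \<gamma> \<sigma> H l \<longleftrightarrow>
     is_arg_max (\<lambda>l. \<Sum>k\<in>UNIV. l $ k * (\<sigma> k)\<^sup>2) (dual_feasible b \<gamma> H) l"

text \<open>Meaningful only where the dual problem has exactly one optimal solution.\<close>

definition dual_multipliers ::
  "('k::finite \<Rightarrow> 'b::finite) \<Rightarrow> ('k \<Rightarrow> real) \<Rightarrow> ('k \<Rightarrow> real) \<Rightarrow> complex^'n^'k^'b \<Rightarrow> real^'k"
where
  "dual_multipliers b \<gamma> \<sigma> H = (THE l. dual_optimal b \<gamma> \<sigma> H l)"

end

theory Submission
  imports Defs
begin

text \<open>
  The dual constraint of user \<open>k\<close> says that a Hermitian form \<open>constraint_form\<close>, which is affine
  in the multipliers \<open>l\<close> with constant part \<open>norm x\<^sup>2\<close>, is nonnegative. Increasing the multipliers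
  of the other users relaxes this constraint, so the feasible set is closed under componentwise
  maxima. A beam-former meeting the SINR targets bounds the feasible set, by weak duality. A linear
  objective with positive weights on a nonempty compact set closed under maxima has exactly one
  maximizer, the componentwise greatest point. Thus \<open>dual_multipliers\<close> is the greatest feasible
  point (lemma \<open>dual_optimal_greatest\<close>).

  Continuity follows from this description by shrinking. If \<open>l\<close> is feasible for a channel \<open>H\<close>, then
  at \<open>(1 - s) l\<close> every constraint form is at least \<open>s * norm x\<^sup>2\<close>, because its constant
  part does not shrink. This margin absorbs a small change of the channel, so \<open>(1 - s) l\<close> is
  feasible for all nearby \<open>H'\<close> and hence lies below the greatest feasible point of \<open>H'\<close>. A single
  strictly feasible beam-former for \<open>H\<close> also serves all nearby channels, so that the multipliers
  have a common bound \<open>M\<close> there, and the roles of \<open>H\<close> and \<open>H'\<close> can be exchanged. The two greatest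
  points then differ by at most \<open>s * M\<close> in every component.
\<close>

section \<open>The dual constraints as Hermitian forms\<close>

lemma cdot_sum_right: "cdot x (\<Sum>i\<in>S. f i) = (\<Sum>i\<in>S. cdot x (f i))"
  unfolding cdot_def by (simp add: sum_distrib_left, rule sum.swap)

lemma cdot_add_right: "cdot x (y + z) = cdot x y + cdot x z"
  by (simp add: cdot_def algebra_simps sum.distrib)

lemma cdot_diff_right: "cdot x (y - z) = cdot x y - cdot x z"
  by (simp add: cdot_def algebra_simps sum_subtractf)

lemma cdot_diff_left: "cdot (x - y) z = cdot x z - cdot y z"
  by (simp add: cdot_def algebra_simps sum_subtractf)

lemma cdot_scaleR_right: "cdot x (r *\<^sub>R y) = r *\<^sub>R cdot x y"
  by (simp add: cdot_def scaleR_sum_right)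

lemma cdot_cauchy_schwarz: "cmod (cdot x y) \<le> norm x * norm y"
proof -
  have "cmod (cdot x y) \<le> (\<Sum>i\<in>UNIV. \<bar>cmod (x $ i)\<bar> * \<bar>cmod (y $ i)\<bar>)"
    unfolding cdot_def by (rule order_trans[OF norm_sum]) (simp add: norm_mult)
  also have "\<dots> \<le> norm x * norm y"
    unfolding norm_vec_def by (rule L2_set_mult_ineq)
  finally show ?thesis .
qed

lemma Re_cdot_self: "Re (cdot x x) = (norm x)\<^sup>2"
proof -
  have "Re (cdot x x) = (\<Sum>i\<in>UNIV. (cmod (x $ i))\<^sup>2)"
    unfolding cdot_def Re_sum by (rule sum.cong) (simp_all add: cmod_power2 power2_eq_square[symmetric])
  also have "\<dots> = (norm x)\<^sup>2"
    by (simp add: norm_vec_def L2_set_def sum_nonneg)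
  finally show ?thesis .
qed

lemma cnj_cdot: "cnj (cdot x y) = cdot y x"
  by (simp add: cdot_def mult.commute)

lemma Re_cdot_outer: "Re (cdot x (outer h h *v x)) = (cmod (cdot h x))\<^sup>2"
proof -
  have "outer h h *v x = (\<chi> i. h $ i * cdot h x)"
    by (simp add: outer_def matrix_vector_mult_def cdot_def vec_eq_iff sum_distrib_left mult.assoc)
  then have "cdot x (outer h h *v x) = cnj (cdot h x) * cdot h x"
    unfolding cdot_def[of x] cnj_cdot by (simp add: cdot_def[of x h] sum_distrib_right mult.assoc)
  also have "\<dots> = of_real ((cmod (cdot h x))\<^sup>2)"
    by (metis complex_norm_square mult.commute of_real_power)
  finally show ?thesis by simp
qed

lemma matrix_vector_mult_sum_left:
  fixes f :: "'a \<Rightarrow> complex^'n^'m"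
  shows "(\<Sum>i\<in>S. f i) *v x = (\<Sum>i\<in>S. f i *v x)"
  by (induction S rule: infinite_finite_induct) (simp_all add: matrix_vector_mult_add_rdistrib)

lemma scaleR_matrix_vector_mult_left:
  fixes A :: "complex^'n^'m"
  shows "(r *\<^sub>R A) *v x = r *\<^sub>R (A *v x)"
  by (simp add: matrix_vector_mult_def vec_eq_iff scaleR_sum_right)

definition constraint_form ::
  "('k::finite \<Rightarrow> 'b::finite) \<Rightarrow> ('k \<Rightarrow> real) \<Rightarrow> complex^'n^'k^'b \<Rightarrow> real^'k \<Rightarrow> 'k \<Rightarrow> complex^'n \<Rightarrow> real"
where
  "constraint_form b \<gamma> H l k x =
     (norm x)\<^sup>2 + (\<Sum>j\<in>UNIV. l $ j * (cmod (cdot (H $ b k $ j) x))\<^sup>2)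
     - (1 + 1 / \<gamma> k) * l $ k * (cmod (cdot (H $ b k $ k) x))\<^sup>2"

lemma dual_feasible_iff:
  "dual_feasible b \<gamma> H l \<longleftrightarrow> (\<forall>k. 0 \<le> l $ k) \<and> (\<forall>k x. 0 \<le> constraint_form b \<gamma> H l k x)"
proof -
  have "psd (mat 1 + (\<Sum>j\<in>UNIV. (l $ j) *\<^sub>R outer (H $ b k $ j) (H $ b k $ j))
          - ((1 + 1 / \<gamma> k) * l $ k) *\<^sub>R outer (H $ b k $ k) (H $ b k $ k))
        \<longleftrightarrow> (\<forall>x. 0 \<le> constraint_form b \<gamma> H l k x)" (is "psd ?A \<longleftrightarrow> _") for k
  proof -
    have "adj ?A = ?A"
      by (simp add: adj_def outer_def mat_def vec_eq_iff mult.commute)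
    moreover have "Re (cdot x (?A *v x)) = constraint_form b \<gamma> H l k x" for x
      by (simp add: constraint_form_def matrix_vector_mult_add_rdistrib
          matrix_vector_mult_diff_rdistrib matrix_vector_mult_sum_left
          scaleR_matrix_vector_mult_left cdot_add_right cdot_diff_right cdot_sum_right
          cdot_scaleR_right Re_cdot_self Re_cdot_outer)
    ultimately show ?thesis by (simp add: psd_def)
  qed
  then show ?thesis by (simp add: dual_feasible_def loewner_ge_def)
qed

section \<open>Weak duality\<close>

text \<open>
  Adding the own signal power to the interference turns it into one sum over all users, the primal
  counterpart of the full sum over \<open>j\<close> in the dual constraints; the factor \<open>1 / \<gamma> k\<close> then becomes
  \<open>1 + 1 / \<gamma> k\<close>.
\<close>

definition margin ::
  "('k::finite \<Rightarrow> 'b::finite) \<Rightarrow> ('k \<Rightarrow> real) \<Rightarrow> complex^'n^'k \<Rightarrow> complex^'n^'k^'b \<Rightarrow> 'k \<Rightarrow> real"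
where
  "margin b \<gamma> W H k = (1 + 1 / \<gamma> k) * (cmod (cdot (H $ b k $ k) (W $ k)))\<^sup>2
     - (\<Sum>i\<in>UNIV. (cmod (cdot (H $ b i $ k) (W $ i)))\<^sup>2)"

lemma SINR_gt_iff_margin:
  assumes "\<gamma> k > 0" "(\<sigma> k)\<^sup>2 > 0"
  shows "SINR b \<sigma> W H k > \<gamma> k \<longleftrightarrow> margin b \<gamma> W H k > (\<sigma> k)\<^sup>2"
proof -
  define f where "f m i = (cmod (cdot (H $ m $ k) (W $ i)))\<^sup>2" for m i
  define I where "I = (\<Sum>i\<in>users b (b k) - {k}. f (b k) i)
      + (\<Sum>m\<in>UNIV - {b k}. \<Sum>i\<in>users b m. f m i)"
  have "(\<Sum>i\<in>UNIV. f (b i) i) = (\<Sum>m\<in>UNIV. \<Sum>i\<in>users b m. f (b i) i)"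
    using sum.group[of UNIV UNIV b "\<lambda>i. f (b i) i"] by (simp add: users_def)
  also have "\<dots> = (\<Sum>m\<in>UNIV. \<Sum>i\<in>users b m. f m i)"
    by (intro sum.cong) (auto simp: users_def)
  also have "\<dots> = (\<Sum>i\<in>users b (b k). f (b k) i) + (\<Sum>m\<in>UNIV - {b k}. \<Sum>i\<in>users b m. f m i)"
    by (simp add: sum.remove)
  also have "(\<Sum>i\<in>users b (b k). f (b k) i) = f (b k) k + (\<Sum>i\<in>users b (b k) - {k}. f (b k) i)"
    by (rule sum.remove) (simp_all add: users_def)
  finally have total: "(\<Sum>i\<in>UNIV. f (b i) i) = f (b k) k + I"
    by (simp add: I_def)
  have "I \<ge> 0"
    unfolding I_def f_def by (intro add_nonneg_nonneg sum_nonneg) auto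
  then have "I + (\<sigma> k)\<^sup>2 > 0" using assms by linarith
  have "SINR b \<sigma> W H k = f (b k) k / (I + (\<sigma> k)\<^sup>2)"
    by (simp add: SINR_def f_def I_def)
  moreover have "margin b \<gamma> W H k = f (b k) k / \<gamma> k - I"
    using total by (simp add: margin_def f_def algebra_simps)
  ultimately show ?thesis
    using assms \<open>I + (\<sigma> k)\<^sup>2 > 0\<close>
    by (simp add: pos_less_divide_eq less_diff_eq) (simp add: algebra_simps)
qed

text \<open>
  Evaluating the constraint form of user \<open>k\<close> at the beam-former \<open>W $ k\<close> and summing over \<open>k\<close>
  exchanges the two channel indices, which turns dual into primal interference.
\<close>

lemma weak_duality:
  assumes "dual_feasible b \<gamma> H l"
  shows "(\<Sum>k\<in>UNIV. l $ k * margin b \<gamma> W H k) \<le> (\<Sum>k\<in>UNIV. (norm (W $ k))\<^sup>2)"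
proof -
  let ?a = "\<lambda>i j. (cmod (cdot (H $ b i $ j) (W $ i)))\<^sup>2"
  have "0 \<le> (\<Sum>k\<in>UNIV. constraint_form b \<gamma> H l k (W $ k))"
    using assms by (intro sum_nonneg) (auto simp: dual_feasible_iff)
  also have "\<dots> = (\<Sum>k\<in>UNIV. (norm (W $ k))\<^sup>2) + (\<Sum>k\<in>UNIV. \<Sum>j\<in>UNIV. l $ j * ?a k j)
      - (\<Sum>k\<in>UNIV. (1 + 1 / \<gamma> k) * l $ k * ?a k k)"
    unfolding constraint_form_def by (simp only: sum.distrib sum_subtractf)
  also have "(\<Sum>k\<in>UNIV. \<Sum>j\<in>UNIV. l $ j * ?a k j) = (\<Sum>k\<in>UNIV. \<Sum>i\<in>UNIV. l $ k * ?a i k)"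
    by (rule sum.swap)
  also have "(\<Sum>k\<in>UNIV. (norm (W $ k))\<^sup>2) + (\<Sum>k\<in>UNIV. \<Sum>i\<in>UNIV. l $ k * ?a i k)
      - (\<Sum>k\<in>UNIV. (1 + 1 / \<gamma> k) * l $ k * ?a k k)
      = (\<Sum>k\<in>UNIV. (norm (W $ k))\<^sup>2) - (\<Sum>k\<in>UNIV. l $ k * margin b \<gamma> W H k)"
    unfolding margin_def right_diff_distrib sum_subtractf sum_distrib_left
    by (simp add: mult_ac)
  finally show ?thesis by simp
qed

text \<open>
  The bound is uniform near \<open>H\<close>: the margins depend continuously on the channel, so a beam-former
  that is strictly feasible for \<open>H\<close> works for all nearby channels with the same total power.
\<close>

lemma dual_feasible_locally_bounded:
  fixes b :: "'k::finite \<Rightarrow> 'b::finite" and H :: "complex^'n^'k^'b"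
  assumes "\<And>k. \<gamma> k > 0" "\<And>k. (\<sigma> k)\<^sup>2 > 0" "strictly_feasible b \<gamma> \<sigma> H"
  obtains M where "M > 0"
    "\<forall>\<^sub>F H' in nhds H. \<forall>l. dual_feasible b \<gamma> H' l \<longrightarrow> (\<forall>k. l $ k \<le> M)"
proof -
  obtain W where W: "\<And>k. margin b \<gamma> W H k > (\<sigma> k)\<^sup>2"
    using assms by (auto simp: strictly_feasible_def SINR_gt_iff_margin)
  define P where "P = (\<Sum>k\<in>UNIV. (norm (W $ k))\<^sup>2)"
  define M where "M = 1 + (\<Sum>k\<in>UNIV. P / (\<sigma> k)\<^sup>2)"
  have "P \<ge> 0" unfolding P_def by (intro sum_nonneg) auto
  have "isCont (\<lambda>H. margin b \<gamma> W H k) H" for k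
    unfolding margin_def cdot_def by (intro continuous_intros)
  then have "\<forall>\<^sub>F H' in nhds H. margin b \<gamma> W H' k > (\<sigma> k)\<^sup>2" for k
    using W[of k] by (metis continuous_at tendsto_at_iff_tendsto_nhds order_tendstoD(1))
  then have "\<forall>\<^sub>F H' in nhds H. \<forall>k. margin b \<gamma> W H' k > (\<sigma> k)\<^sup>2"
    by (simp add: eventually_all_finite)
  then have "\<forall>\<^sub>F H' in nhds H. \<forall>l. dual_feasible b \<gamma> H' l \<longrightarrow> (\<forall>k. l $ k \<le> M)"
  proof eventually_elim
    case (elim H')
    show ?case
    proof (intro allI impI)
      fix l k assume l: "dual_feasible b \<gamma> H' l"
      then have nonneg: "l $ j \<ge> 0" for j by (simp add: dual_feasible_iff)
      have "l $ k * (\<sigma> k)\<^sup>2 \<le> (\<Sum>k\<in>UNIV. l $ k * (\<sigma> k)\<^sup>2)"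
        by (rule member_le_sum) (simp_all add: nonneg)
      also have "\<dots> \<le> (\<Sum>k\<in>UNIV. l $ k * margin b \<gamma> W H' k)"
        using elim nonneg by (intro sum_mono mult_left_mono) (auto intro: less_imp_le)
      also have "\<dots> \<le> P"
        unfolding P_def by (rule weak_duality[OF l])
      finally have "l $ k \<le> P / (\<sigma> k)\<^sup>2"
        using assms(2)[of k] by (simp add: pos_le_divide_eq)
      also have "\<dots> \<le> (\<Sum>k\<in>UNIV. P / (\<sigma> k)\<^sup>2)"
        using \<open>P \<ge> 0\<close> by (intro member_le_sum) auto
      finally show "l $ k \<le> M" by (simp add: M_def)
    qed
  qed
  moreover have "M > 0"
    unfolding M_def using \<open>P \<ge> 0\<close> by (intro add_pos_nonneg sum_nonneg) auto
  ultimately show ?thesis using that by blast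
qed

section \<open>The greatest dual feasible point\<close>

lemma closed_dual_feasible: "closed {l. dual_feasible b \<gamma> H l}"
  unfolding dual_feasible_iff constraint_form_def
  by (intro closed_Collect_conj closed_Collect_all closed_Collect_le continuous_intros)

text \<open>
  At user \<open>k\<close> the maximum agrees with one of the two points in the coordinate \<open>k\<close> and is at least
  as large in all others, whose coefficients in the constraint form are nonnegative.
\<close>

lemma dual_feasible_max:
  assumes "dual_feasible b \<gamma> H l" "dual_feasible b \<gamma> H m"
  shows "dual_feasible b \<gamma> H (\<chi> k. max (l $ k) (m $ k))" (is "dual_feasible b \<gamma> H ?n")
proof -
  have mono: "constraint_form b \<gamma> H u k x \<le> constraint_form b \<gamma> H v k x"
    if "\<And>j. u $ j \<le> v $ j" "u $ k = v $ k" for u v k x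
    unfolding constraint_form_def using that
    by (intro add_mono diff_mono sum_mono mult_right_mono) auto
  have "0 \<le> constraint_form b \<gamma> H ?n k x" for k x
  proof (cases "m $ k \<le> l $ k")
    case True
    then show ?thesis
      using mono[of l ?n k x] assms(1) by (force simp: dual_feasible_iff intro: order_trans)
  next
    case False
    then show ?thesis
      using mono[of m ?n k x] assms(2) by (force simp: dual_feasible_iff intro: order_trans)
  qed
  then show ?thesis
    using assms by (auto simp: dual_feasible_iff le_max_iff_disj)
qed

text \<open>
  A feasible point not below an optimal one would, by taking the maximum of both, increase the
  objective, since all its weights are positive.
\<close>

lemma dual_optimal_greatest:
  assumes "\<And>k. (\<sigma> k)\<^sup>2 > 0" "dual_optimal b \<gamma> \<sigma> H l" "dual_feasible b \<gamma> H m"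
  shows "m $ k \<le> l $ k"
proof (rule ccontr)
  assume less: "\<not> m $ k \<le> l $ k"
  let ?n = "\<chi> k. max (l $ k) (m $ k)"
  have "dual_feasible b \<gamma> H ?n"
    using assms by (intro dual_feasible_max) (auto simp: dual_optimal_def is_arg_max_def)
  moreover have "(\<Sum>k\<in>UNIV. l $ k * (\<sigma> k)\<^sup>2) < (\<Sum>k\<in>UNIV. ?n $ k * (\<sigma> k)\<^sup>2)"
    using less assms(1)[of k]
    by (intro sum_strict_mono_ex1 ballI bexI[of _ k]) (auto intro: mult_right_mono)
  ultimately show False
    using assms(2) by (auto simp: dual_optimal_def is_arg_max_def)
qed

lemma ex1_dual_optimal:
  fixes b :: "'k::finite \<Rightarrow> 'b::finite" and H :: "complex^'n^'k^'b"
  assumes "\<And>k. \<gamma> k > 0" "\<And>k. (\<sigma> k)\<^sup>2 > 0" "strictly_feasible b \<gamma> \<sigma> H"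
  shows "\<exists>!l. dual_optimal b \<gamma> \<sigma> H l"
proof (rule ex_ex1I)
  let ?D = "{l. dual_feasible b \<gamma> H l}"
  obtain M where "M > 0" "\<forall>\<^sub>F H' in nhds H. \<forall>l. dual_feasible b \<gamma> H' l \<longrightarrow> (\<forall>k. l $ k \<le> M)"
    using dual_feasible_locally_bounded[OF assms] by blast
  then have "?D \<subseteq> cbox 0 (\<chi> k. M)"
    by (auto simp: mem_box_cart dual_feasible_iff dest: eventually_nhds_x_imp_x)
  then have "bounded ?D" using bounded_cbox bounded_subset by blast
  then have "compact ?D" using closed_dual_feasible by (simp add: compact_eq_bounded_closed)
  moreover have "0 \<in> ?D" by (simp add: dual_feasible_iff constraint_form_def)
  moreover have "continuous_on ?D (\<lambda>l. \<Sum>k\<in>UNIV. l $ k * (\<sigma> k)\<^sup>2)"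
    by (intro continuous_intros)
  ultimately obtain l where "l \<in> ?D"
    "\<forall>m\<in>?D. (\<Sum>k\<in>UNIV. m $ k * (\<sigma> k)\<^sup>2) \<le> (\<Sum>k\<in>UNIV. l $ k * (\<sigma> k)\<^sup>2)"
    using continuous_attains_sup[of ?D "\<lambda>l. \<Sum>k\<in>UNIV. l $ k * (\<sigma> k)\<^sup>2"] by blast
  then show "\<exists>l. dual_optimal b \<gamma> \<sigma> H l"
    by (force simp: dual_optimal_def is_arg_max_def not_less)
next
  fix l m assume lm: "dual_optimal b \<gamma> \<sigma> H l" "dual_optimal b \<gamma> \<sigma> H m"
  then have "dual_feasible b \<gamma> H l" "dual_feasible b \<gamma> H m"
    by (auto simp: dual_optimal_def is_arg_max_def)
  then show "l = m"
    using dual_optimal_greatest[where \<sigma> = \<sigma>] assms(2) lm by (metis antisym vec_eq_iff)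
qed

section \<open>Perturbation of the channel\<close>

lemma cmod_cdot_power2_diff:
  "\<bar>(cmod (cdot h x))\<^sup>2 - (cmod (cdot g x))\<^sup>2\<bar> \<le> norm (h - g) * (norm h + norm g) * (norm x)\<^sup>2"
proof -
  have "\<bar>(cmod (cdot h x))\<^sup>2 - (cmod (cdot g x))\<^sup>2\<bar>
      = \<bar>cmod (cdot h x) - cmod (cdot g x)\<bar> * (cmod (cdot h x) + cmod (cdot g x))"
    by (simp add: power2_eq_square square_diff_square_factored abs_mult mult.commute)
  also have "\<dots> \<le> (norm (h - g) * norm x) * (norm h * norm x + norm g * norm x)"
  proof (intro mult_mono add_mono cdot_cauchy_schwarz)
    have "\<bar>cmod (cdot h x) - cmod (cdot g x)\<bar> \<le> cmod (cdot (h - g) x)"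
      unfolding cdot_diff_left by (rule norm_triangle_ineq3)
    then show "\<bar>cmod (cdot h x) - cmod (cdot g x)\<bar> \<le> norm (h - g) * norm x"
      using cdot_cauchy_schwarz order_trans by blast
  qed auto
  finally show ?thesis by (simp add: power2_eq_square algebra_simps)
qed

text \<open>
  The neighbourhood depends only on the bound \<open>M\<close>, not on \<open>l\<close>. It therefore serves the multipliers
  of every nearby channel at once, not only those of \<open>H\<close>.
\<close>

lemma constraint_form_perturbation:
  fixes b :: "'k::finite \<Rightarrow> 'b::finite" and H :: "complex^'n^'k^'b"
  assumes "\<And>k. \<gamma> k > 0" "M > 0" "s > 0"
  shows "\<forall>\<^sub>F H' in nhds H. \<forall>l k x. (\<forall>j. 0 \<le> l $ j \<and> l $ j \<le> M) \<longrightarrow>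
    \<bar>constraint_form b \<gamma> H' l k x - constraint_form b \<gamma> H l k x\<bar> \<le> s * (norm x)\<^sup>2"
proof -
  define d where "d H' m j = norm (H' $ m $ j - H $ m $ j) * (norm (H' $ m $ j) + norm (H $ m $ j))"
    for H' :: "complex^'n^'k^'b" and m j
  define D where "D H' k = M * ((\<Sum>j\<in>UNIV. d H' (b k) j) + (1 + 1 / \<gamma> k) * d H' (b k) k)" for H' k
  have "isCont (\<lambda>H'. D H' k) H" for k
    unfolding D_def d_def by (intro continuous_intros)
  moreover have "D H k = 0" for k
    by (simp add: D_def d_def)
  ultimately have "\<forall>\<^sub>F H' in nhds H. D H' k < s" for k
    using \<open>s > 0\<close> by (metis continuous_at tendsto_at_iff_tendsto_nhds order_tendstoD(2))
  then have "\<forall>\<^sub>F H' in nhds H. \<forall>k. D H' k < s"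
    by (simp add: eventually_all_finite)
  then show ?thesis
  proof eventually_elim
    case (elim H')
    show ?case
    proof (intro allI impI)
      fix l :: "real^'k" and k and x :: "complex^'n"
      assume l: "\<forall>j. 0 \<le> l $ j \<and> l $ j \<le> M"
      let ?e = "\<lambda>j. (cmod (cdot (H' $ b k $ j) x))\<^sup>2 - (cmod (cdot (H $ b k $ j) x))\<^sup>2"
      have e: "\<bar>l $ j * ?e j\<bar> \<le> M * (d H' (b k) j * (norm x)\<^sup>2)" for j
        unfolding abs_mult d_def using l \<open>M > 0\<close>
        by (intro mult_mono cmod_cdot_power2_diff) auto
      have c: "0 \<le> 1 + 1 / \<gamma> k" using assms(1)[of k] by simp
      have "constraint_form b \<gamma> H' l k x - constraint_form b \<gamma> H l k x
          = (\<Sum>j\<in>UNIV. l $ j * ?e j) - (1 + 1 / \<gamma> k) * (l $ k * ?e k)"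
        by (simp add: constraint_form_def right_diff_distrib sum_subtractf)
      also have "\<bar>\<dots>\<bar> \<le> (\<Sum>j\<in>UNIV. \<bar>l $ j * ?e j\<bar>) + (1 + 1 / \<gamma> k) * \<bar>l $ k * ?e k\<bar>"
        by (rule order_trans[OF abs_triangle_ineq4])
           (use c in \<open>simp add: abs_mult[of "1 + 1 / \<gamma> k"] sum_abs\<close>)
      also have "\<dots> \<le> (\<Sum>j\<in>UNIV. M * (d H' (b k) j * (norm x)\<^sup>2))
          + (1 + 1 / \<gamma> k) * (M * (d H' (b k) k * (norm x)\<^sup>2))"
        by (intro add_mono sum_mono mult_left_mono e c)
      also have "\<dots> = D H' k * (norm x)\<^sup>2"
        by (simp add: D_def sum_distrib_left sum_distrib_right algebra_simps)
      also have "\<dots> \<le> s * (norm x)\<^sup>2"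
        using elim by (intro mult_right_mono) (auto intro: less_imp_le)
      finally show "\<bar>constraint_form b \<gamma> H' l k x - constraint_form b \<gamma> H l k x\<bar> \<le> s * (norm x)\<^sup>2" .
    qed
  qed
qed

text \<open>
  The form at \<open>(1 - s) l\<close> is the convex combination, with weights \<open>s\<close> and \<open>1 - s\<close>, of the form at
  zero, which is \<open>norm x\<^sup>2\<close>, and the form at \<open>l\<close>. The first part pays for a perturbation of the
  second of size \<open>s * norm x\<^sup>2\<close>.
\<close>

lemma dual_feasible_shrink:
  assumes "dual_feasible b \<gamma> H l" "0 \<le> s" "s \<le> 1"
    and close: "\<And>k x. \<bar>constraint_form b \<gamma> H' l k x - constraint_form b \<gamma> H l k x\<bar> \<le> s * (norm x)\<^sup>2"
  shows "dual_feasible b \<gamma> H' ((1 - s) *\<^sub>R l)"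
proof -
  have "0 \<le> constraint_form b \<gamma> H' ((1 - s) *\<^sub>R l) k x" for k x
  proof -
    have "constraint_form b \<gamma> H' ((1 - s) *\<^sub>R l) k x
        = s * (norm x)\<^sup>2 + (1 - s) * constraint_form b \<gamma> H' l k x"
      by (simp add: constraint_form_def sum_distrib_left sum_subtractf algebra_simps
          diff_divide_distrib)
    moreover have "constraint_form b \<gamma> H' l k x \<ge> - (s * (norm x)\<^sup>2)"
      using close[of k x] assms(1) by (smt (verit) dual_feasible_iff)
    then have "(1 - s) * constraint_form b \<gamma> H' l k x \<ge> (1 - s) * - (s * (norm x)\<^sup>2)"
      using assms(3) by (intro mult_left_mono) auto
    moreover have "s * (norm x)\<^sup>2 + (1 - s) * - (s * (norm x)\<^sup>2) = (s * norm x)\<^sup>2"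
      by (simp add: power2_eq_square algebra_simps)
    ultimately show ?thesis by (smt (verit) zero_le_power2)
  qed
  then show ?thesis
    using assms by (simp add: dual_feasible_iff)
qed

section \<open>Continuity of the optimal multipliers\<close>

theorem lemma4:
  fixes b :: "'k::finite \<Rightarrow> 'b::finite"
    and \<gamma> \<sigma> :: "'k \<Rightarrow> real"
    and \<H> :: "(complex^'n^'k^'b) set"
  assumes "\<And>k. \<gamma> k > 0"
    and "\<And>k. (\<sigma> k)\<^sup>2 > 0"
    and "compact \<H>"
    and "\<And>H. H \<in> \<H> \<Longrightarrow> strictly_feasible b \<gamma> \<sigma> H"
  shows "(\<forall>H\<in>\<H>. \<exists>!l. dual_optimal b \<gamma> \<sigma> H l) \<and>
         (\<forall>k. continuous_on \<H> (\<lambda>H. dual_multipliers b \<gamma> \<sigma> H $ k))"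
proof (intro conjI ballI allI)
  show ex1: "\<exists>!l. dual_optimal b \<gamma> \<sigma> H l" if "H \<in> \<H>" for H
    using ex1_dual_optimal assms that by blast
  let ?l = "dual_multipliers b \<gamma> \<sigma>"
  have opt: "dual_optimal b \<gamma> \<sigma> H (?l H)" if "H \<in> \<H>" for H
    unfolding dual_multipliers_def by (rule theI'[OF ex1[OF that]])
  then have feas: "dual_feasible b \<gamma> H (?l H)" if "H \<in> \<H>" for H
    using that by (auto simp: dual_optimal_def is_arg_max_def)
  fix k
  show "continuous_on \<H> (\<lambda>H. ?l H $ k)"
    unfolding continuous_on_def
  proof (intro ballI tendstoI)
    fix H and \<epsilon> :: real assume H: "H \<in> \<H>" and "\<epsilon> > 0"
    obtain M where "M > 0"
      and M: "\<forall>\<^sub>F H' in nhds H. \<forall>l. dual_feasible b \<gamma> H' l \<longrightarrow> (\<forall>k. l $ k \<le> M)"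
      using dual_feasible_locally_bounded[OF assms(1,2) assms(4)[OF H]] by blast
    \<comment> \<open>Shrinking needs \<open>s \<le> 1\<close>; halving \<open>\<epsilon>\<close> makes the final estimate strict.\<close>
    define s where "s = min 1 (\<epsilon> / (2 * M))"
    have s: "s > 0" "s \<le> 1" using \<open>\<epsilon> > 0\<close> \<open>M > 0\<close> by (auto simp: s_def)
    have "s * M \<le> \<epsilon> / (2 * M) * M"
      using \<open>M > 0\<close> by (intro mult_right_mono) (auto simp: s_def)
    then have sM: "s * M < \<epsilon>" using \<open>M > 0\<close> \<open>\<epsilon> > 0\<close> by simp
    \<comment> \<open>Stated for two arbitrary channels because it is used with \<open>H\<close> and \<open>H'\<close> in both orders.\<close>
    have below: "?l G $ k - ?l G' $ k \<le> s * M"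
      if "G \<in> \<H>" "G' \<in> \<H>" "?l G $ k \<le> M"
        and "\<And>k x. \<bar>constraint_form b \<gamma> G' (?l G) k x - constraint_form b \<gamma> G (?l G) k x\<bar> \<le> s * (norm x)\<^sup>2"
      for G G'
    proof -
      have "dual_feasible b \<gamma> G' ((1 - s) *\<^sub>R ?l G)"
        using feas that s by (intro dual_feasible_shrink) auto
      then have "((1 - s) *\<^sub>R ?l G) $ k \<le> ?l G' $ k"
        using dual_optimal_greatest assms(2) opt that(2) by blast
      then have "?l G $ k - ?l G' $ k \<le> s * ?l G $ k" by (simp add: algebra_simps)
      also have "\<dots> \<le> s * M" using that(3) s by simp
      finally show ?thesis .
    qed
    have M0: "?l H $ j \<le> M" for j
      using eventually_nhds_x_imp_x[OF M] feas[OF H] by blast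
    have "\<forall>\<^sub>F H' in nhds H. H' \<in> \<H> \<longrightarrow> dist (?l H' $ k) (?l H $ k) < \<epsilon>"
      using M constraint_form_perturbation[where H = H and b = b and \<gamma> = \<gamma>, OF assms(1) \<open>M > 0\<close> s(1)]
    proof eventually_elim
      case (elim H')
      show ?case
      proof
        assume H': "H' \<in> \<H>"
        have M': "?l H' $ j \<le> M" for j using elim(1) feas[OF H'] by blast
        have nonneg: "0 \<le> ?l H $ j" "0 \<le> ?l H' $ j" for j
          using feas H H' by (auto simp: dual_feasible_iff)
        have "?l H $ k - ?l H' $ k \<le> s * M"
          using elim(2) M0 nonneg by (intro below H H') auto
        moreover have "?l H' $ k - ?l H $ k \<le> s * M"
        proof (intro below H H' M')
          show "\<bar>constraint_form b \<gamma> H (?l H') k x - constraint_form b \<gamma> H' (?l H') k x\<bar> \<le> s * (norm x)\<^sup>2" for k x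
            using elim(2) M' nonneg by (subst abs_minus_commute) auto
        qed
        ultimately show "dist (?l H' $ k) (?l H $ k) < \<epsilon>"
          using sM by (simp add: dist_real_def)
      qed
    qed
    then show "\<forall>\<^sub>F H' in at H within \<H>. dist (?l H' $ k) (?l H $ k) < \<epsilon>"
      by (auto simp: eventually_at_filter elim: eventually_mono)
  qed
qed

end
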